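(* Let $k\in\mathbb{N}$, let $F=(f_1,\dots,f_m)$ be a sequence of $k$-relabeling functions, and let $\mathsf{D}$ be a coherent DP-core with identity cleaning equipped with a witness action. If there is an $F$-relabeled $(k,\mathsf{D})$-refutation, then there exists a $k$-instructive tree decomposition $\tau\in\mathcal{T}_k$ such that $G(\tau)\notin\mathcal{P}(\mathsf{D})$.
   Context: Graphs. A graph is a triple $G=(V,E,\rho)$ with $V,E$ finite subsets of $\mathbb{N}$ and $\rho\subseteq E\times V$ such that each edge is incident to exactly two distinct vertices (parallel edges allowed). A graph property is a set of graphs closed under isomorphism. Instructive decompositions. The $k$-instructive alphabet consists of $\mathtt{Leaf}$ (arity 0), $\mathtt{IntroVertex}_u$, $\mathtt{ForgetVertex}_u$ ($u\in[k+1]$), $\mathtt{IntroEdge}_{u,v}$ (distinct $u,v\in[k+1]$) of arity 1, and $\mathtt{Join}$ (arity 2). $\mathcal{T}_k$ is the set of terms legal with respect to bags: $\mathtt{Leaf}$ has bag $\emptyset$; $\mathtt{IntroVertex}_u(\sigma)$ requires $u\notin$ bag$(\sigma)$ and adds $u$; $\mathtt{ForgetVertex}_u(\sigma)$ requires $u\in$ bag$(\sigma)$ and removes $u$; $\mathtt{IntroEdge}_{u,v}(\sigma)$ requires $u,v\in$ bag$(\sigma)$; $\mathtt{Join}(\sigma_1,\sigma_2)$ requires equal child bags. Each $\tau\in\mathcal{T}_k$ defines a graph $G(\tau)$ and top bag $B(\tau)$: $\mathtt{Leaf}$ is the empty graph; $\mathtt{IntroVertex}_u$ adds a fresh isolated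 vertex labeled $u$; $\mathtt{ForgetVertex}_u$ removes label $u$; $\mathtt{IntroEdge}_{u,v}$ adds a new edge between the vertices labeled $u,v$; $\mathtt{Join}$ takes the disjoint union of the child graphs identifying, for each bag label, the two vertices carrying it (edges never identified). DP-cores. A DP-core $\mathsf{D}$ assigns to each $k$ a tuple $\mathsf{D}[k]$: a decidable set $\mathcal{W}_k\subseteq\{0,1\}^*$ of witnesses, $\mathtt{Final}_k:\mathcal{W}_k\to\{0,1\}$, a finite set $\mathtt{Leaf}_k\subseteq\mathcal{W}_k$, functions $\mathtt{IntroVertex}_u,\mathtt{ForgetVertex}_u,\mathtt{IntroEdge}_{u,v}:\mathcal{W}_k\to$ finite subsets of $\mathcal{W}_k$, $\mathtt{Join}:\mathcal{W}_k^2\to$ finite subsets, and a cleaning function $\mathtt{Clean}_k$ on finite subsets; transitions are lifted to finite sets by union. The dynamization $\mathrm{Dyn}_k(\tau)$ is $\mathtt{Leaf}_k$ at leaves and otherwise $\mathtt{Clean}_k$ applied to the lifted transition of the children's dynamizations. $\mathsf{D}[k]$ accepts $\tau$ if $\mathrm{Dyn}_k(\tau)$ contains a final witness ($\mathtt{Final}_k(w)=1$). $\mathcal{P}(\mathsf{D})=\bigcup_k$ (isomorphism closure of $\{G(\tau):\tau\in\mathcal{T}_k$ accepted by $\mathsf{D}[k]\}$). Identity cleaning: each $\mathtt{Clean}_k$ is the identity. Coherent: for $\tau\in\mathcal{T}_k$, $\tau'\in\mathcal{T}_{k'}$ with $G(\tau)\cong G(\tau')$, $\mathsf{D}[k]$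 accepts $\tau$ iff $\mathsf{D}[k']$ accepts $\tau'$. Labels, relabelings, witness actions. Each $w\in\mathcal{W}_k$ has a label set $\mathrm{Lbl}_k(w)\subseteq[k+1]$, $\mathrm{Lbl}_k(S)=\bigcup_{w\in S}\mathrm{Lbl}_k(w)$. A $(k,\mathsf{D})$-state $(b,S)$ ($b\subseteq[k+1]$, $S\subseteq\mathcal{W}_k$ finite) is well-formed if $\mathrm{Lbl}_k(S)\subseteq b$, inconsistent if $S$ has no final witness; the initial state is $(\emptyset,\mathtt{Leaf}_k)$. A $k$-relabeling function is an injective $f:b\to[k+1]$ with $b\subseteq[k+1]$; $\mathcal{F}_k$ is the set of these; $f^{-1}$ is the inverse on the image and $f\circ g$ the partial composition. A witness action for $\mathsf{D}[k]$ is a partial map $\rho(f,w)\in\mathcal{W}_k$ defined exactly when $\mathrm{Lbl}_k(w)\subseteq\mathrm{dom}(f)$ (extended pointwise to sets) such that, whenever defined: finality is preserved; $\mathrm{Lbl}_k(\rho(f,w))=f(\mathrm{Lbl}_k(w))$; $\rho(f^{-1},\rho(f,w))=w$; $\rho(f\circ f',w)=\rho(f,\rho(f',w))$; $\rho(f',w)=\rho(f,w)$ when $f'$ extends $f$; and $\rho$ commutes with transitions: $\rho(f,\mathtt{IntroVertex}_u(w))=\mathtt{IntroVertex}_{f(u)}(\rho(f,w))$, likewise for $\mathtt{ForgetVertex}_u$, $\rho(f,\mathtt{IntroEdge}_{u,v}(w))=\mathtt{IntroEdge}_{f(u),f(v)}(\rho(f,w))$, $\rho(f,\mathtt{Join}(w,w'))=\mathtt{Join}(\rho(f,w),\rho(f,w'))$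 (for labels in $\mathrm{dom}(f)$). Being equipped with a witness action means such a $\rho^k$ is fixed for each $k$. Relabeled refutation. For $F=(f_1,\dots,f_m)$, an $F$-relabeled $(k,\mathsf{D})$-refutation is a sequence of states $(b_0,S_0),\dots,(b_m,S_m)$ with $(b_0,S_0)$ initial, $(b_m,S_m)$ inconsistent, all states well-formed, and for each $i\in[m]$ some $j<i$ with $(b_i,S_i)$ equal to one of $(f_i(b_j\cup\{u\}),\rho(f_i,\mathtt{IntroVertex}_u(S_j)))$ ($u\notin b_j$), $(f_i(b_j\setminus\{u\}),\rho(f_i,\mathtt{ForgetVertex}_u(S_j)))$ ($u\in b_j$), $(f_i(b_j),\rho(f_i,\mathtt{IntroEdge}_{u,v}(S_j)))$ (distinct $u,v\in b_j$), or $(f_i(b_j),\rho(f_i,\mathtt{Join}(S_j,\rho(\pi,S_l))))$ ($l<i$, $b_l=b_j$, $\pi$ a permutation of $b_j$), where in each case $\mathrm{dom}(f_i)$ is exactly the bag to which $f_i$ is applied. *)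

theory Defs
  imports Main "HOL-Library.Nat_Bijection"
begin

section \<open>Partial maps\<close>

definition map_image :: "('a \<rightharpoonup> 'b) \<Rightarrow> 'a set \<Rightarrow> 'b set" where
  "map_image f A = {y. \<exists>x\<in>A. f x = Some y}"

definition map_inv :: "('a \<rightharpoonup> 'b) \<Rightarrow> ('b \<rightharpoonup> 'a)" where
  "map_inv f = (\<lambda>y. if y \<in> ran f then Some (THE x. f x = Some y) else None)"


section \<open>Graphs\<close>

record graph =
  verts :: "nat set"
  edges :: "nat set"
  inc :: "(nat \<times> nat) set"  \<comment> \<open>pairs (edge, vertex)\<close>

definition wf_graph :: "graph \<Rightarrow> bool" where
  "wf_graph G \<longleftrightarrow> finite (verts G) \<and> finite (edges G) \<and> inc G \<subseteq> edges G \<times> verts G \<and>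
     (\<forall>e\<in>edges G. card {v. (e, v) \<in> inc G} = 2)"

definition graph_iso :: "graph \<Rightarrow> graph \<Rightarrow> bool" where
  "graph_iso G H \<longleftrightarrow> (\<exists>\<phi> \<psi>. bij_betw \<phi> (verts G) (verts H) \<and> bij_betw \<psi> (edges G) (edges H) \<and>
     (\<forall>e\<in>edges G. \<forall>v\<in>verts G. (e, v) \<in> inc G \<longleftrightarrow> (\<psi> e, \<phi> v) \<in> inc H))"


section \<open>Instructive tree decompositions\<close>

abbreviation labels :: "nat \<Rightarrow> nat set" where
  "labels k \<equiv> {1..k + 1}"

datatype itd =
    Leaf
  | IntroVertex nat itd
  | ForgetVertex nat itd
  | IntroEdge nat nat itd
  | Join itd itd

fun bag :: "itd \<Rightarrow> nat set" where
  "bag Leaf = {}"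
| "bag (IntroVertex u \<sigma>) = insert u (bag \<sigma>)"
| "bag (ForgetVertex u \<sigma>) = bag \<sigma> - {u}"
| "bag (IntroEdge u v \<sigma>) = bag \<sigma>"
| "bag (Join \<sigma>1 \<sigma>2) = bag \<sigma>1"

fun legal :: "nat \<Rightarrow> itd \<Rightarrow> bool" where
  "legal k Leaf \<longleftrightarrow> True"
| "legal k (IntroVertex u \<sigma>) \<longleftrightarrow> legal k \<sigma> \<and> u \<in> labels k \<and> u \<notin> bag \<sigma>"
| "legal k (ForgetVertex u \<sigma>) \<longleftrightarrow> legal k \<sigma> \<and> u \<in> labels k \<and> u \<in> bag \<sigma>"
| "legal k (IntroEdge u v \<sigma>) \<longleftrightarrow>
     legal k \<sigma> \<and> u \<in> labels k \<and> v \<in> labels k \<and> u \<noteq> v \<and> u \<in> bag \<sigma> \<and> v \<in> bag \<sigma>"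
| "legal k (Join \<sigma>1 \<sigma>2) \<longleftrightarrow> legal k \<sigma>1 \<and> legal k \<sigma>2 \<and> bag \<sigma>1 = bag \<sigma>2"

definition itds :: "nat \<Rightarrow> itd set" where
  "itds k = {\<tau>. legal k \<tau>}"

definition fresh :: "nat set \<Rightarrow> nat" where
  "fresh X = (LEAST n. n \<notin> X)"

text \<open>The second component of a labelled graph sends each label of the top bag to the vertex
  carrying it.\<close>

type_synonym labelled_graph = "graph \<times> (nat \<rightharpoonup> nat)"

definition add_vertex :: "nat \<Rightarrow> labelled_graph \<Rightarrow> labelled_graph" where
  "add_vertex u = (\<lambda>(G, \<theta>). let x = fresh (verts G) in
     (G\<lparr>verts := insert x (verts G)\<rparr>, \<theta>(u \<mapsto> x)))"

definition drop_label :: "nat \<Rightarrow> labelled_graph \<Rightarrow> labelled_graph" where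
  "drop_label u = (\<lambda>(G, \<theta>). (G, \<theta>(u := None)))"

definition add_edge :: "nat \<Rightarrow> nat \<Rightarrow> labelled_graph \<Rightarrow> labelled_graph" where
  "add_edge u v = (\<lambda>(G, \<theta>). let e = fresh (edges G) in
     (G\<lparr>edges := insert e (edges G),
        inc := inc G \<union> {(e, the (\<theta> u)), (e, the (\<theta> v))}\<rparr>, \<theta>))"

text \<open>The disjoint union places the first graph on the even and the second graph on the odd
  numbers, except that a vertex of the second graph carrying a label is sent to the image of the
  vertex of the first graph with the same label.\<close>

definition glue :: "(nat \<rightharpoonup> nat) \<Rightarrow> (nat \<rightharpoonup> nat) \<Rightarrow> nat \<Rightarrow> nat" where
  "glue \<theta>1 \<theta>2 v = (case (\<theta>1 \<circ>\<^sub>m map_inv \<theta>2) v of Some v1 \<Rightarrow> 2 * v1 | None \<Rightarrow> 2 * v + 1)"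

definition join_graphs :: "labelled_graph \<Rightarrow> labelled_graph \<Rightarrow> labelled_graph" where
  "join_graphs = (\<lambda>(G1, \<theta>1) (G2, \<theta>2).
     (\<lparr>verts = (\<lambda>v. 2 * v) ` verts G1 \<union> glue \<theta>1 \<theta>2 ` verts G2,
       edges = (\<lambda>e. 2 * e) ` edges G1 \<union> (\<lambda>e. 2 * e + 1) ` edges G2,
       inc = (\<lambda>(e, v). (2 * e, 2 * v)) ` inc G1 \<union>
             (\<lambda>(e, v). (2 * e + 1, glue \<theta>1 \<theta>2 v)) ` inc G2\<rparr>,
      \<lambda>u. map_option (\<lambda>v. 2 * v) (\<theta>1 u)))"

fun itd_labelled_graph :: "itd \<Rightarrow> labelled_graph" where
  "itd_labelled_graph Leaf = (\<lparr>verts = {}, edges = {}, inc = {}\<rparr>, Map.empty)"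
| "itd_labelled_graph (IntroVertex u \<sigma>) = add_vertex u (itd_labelled_graph \<sigma>)"
| "itd_labelled_graph (ForgetVertex u \<sigma>) = drop_label u (itd_labelled_graph \<sigma>)"
| "itd_labelled_graph (IntroEdge u v \<sigma>) = add_edge u v (itd_labelled_graph \<sigma>)"
| "itd_labelled_graph (Join \<sigma>1 \<sigma>2) =
     join_graphs (itd_labelled_graph \<sigma>1) (itd_labelled_graph \<sigma>2)"

definition itd_graph :: "itd \<Rightarrow> graph" where
  "itd_graph \<tau> = fst (itd_labelled_graph \<tau>)"


section \<open>Decidable sets of words\<close>

text \<open>Decidability is taken with respect to Kleene's partial recursive functions.\<close>

datatype recf = Zero | Succ | Proj nat | Comp recf "recf list" | PrimRec recf recf | Mu recf

inductive computes :: "recf \<Rightarrow> nat list \<Rightarrow> nat \<Rightarrow> bool" where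
  "computes Zero xs 0"
| "computes Succ [x] (Suc x)"
| "i < length xs \<Longrightarrow> computes (Proj i) xs (xs ! i)"
| "list_all2 (\<lambda>g y. computes g xs y) gs ys \<Longrightarrow> computes f ys z \<Longrightarrow> computes (Comp f gs) xs z"
| "computes f xs y \<Longrightarrow> computes (PrimRec f g) (0 # xs) y"
| "computes (PrimRec f g) (n # xs) y \<Longrightarrow> computes g (n # y # xs) z \<Longrightarrow>
     computes (PrimRec f g) (Suc n # xs) z"
| "computes f (n # xs) 0 \<Longrightarrow> (\<forall>i<n. \<exists>y. computes f (i # xs) (Suc y)) \<Longrightarrow>
     computes (Mu f) xs n"

definition decidable :: "bool list set \<Rightarrow> bool" where
  "decidable W \<longleftrightarrow>
     (\<exists>f. \<forall>w. computes f [list_encode (map of_bool w)] (if w \<in> W then 1 else 0))"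


section \<open>DP-cores\<close>

type_synonym witness = "bool list"

record dp_level =
  wits :: "witness set"
  final :: "witness \<Rightarrow> bool"
  leaf_wits :: "witness set"
  intro_vertex :: "nat \<Rightarrow> witness \<Rightarrow> witness set"
  forget_vertex :: "nat \<Rightarrow> witness \<Rightarrow> witness set"
  intro_edge :: "nat \<Rightarrow> nat \<Rightarrow> witness \<Rightarrow> witness set"
  join_wits :: "witness \<Rightarrow> witness \<Rightarrow> witness set"
  clean :: "witness set \<Rightarrow> witness set"

definition fin_subsets :: "dp_level \<Rightarrow> witness set set" where
  "fin_subsets L = {S. S \<subseteq> wits L \<and> finite S}"

definition wf_dp_level :: "nat \<Rightarrow> dp_level \<Rightarrow> bool" where
  "wf_dp_level k L \<longleftrightarrow>
     decidable (wits L) \<and>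
     leaf_wits L \<in> fin_subsets L \<and>
     (\<forall>u\<in>labels k. \<forall>w\<in>wits L. intro_vertex L u w \<in> fin_subsets L) \<and>
     (\<forall>u\<in>labels k. \<forall>w\<in>wits L. forget_vertex L u w \<in> fin_subsets L) \<and>
     (\<forall>u\<in>labels k. \<forall>v\<in>labels k. u \<noteq> v \<longrightarrow> (\<forall>w\<in>wits L. intro_edge L u v w \<in> fin_subsets L)) \<and>
     (\<forall>w\<in>wits L. \<forall>w'\<in>wits L. join_wits L w w' \<in> fin_subsets L) \<and>
     (\<forall>S\<in>fin_subsets L. clean L S \<in> fin_subsets L)"

definition dp_core :: "(nat \<Rightarrow> dp_level) \<Rightarrow> bool" where
  "dp_core D \<longleftrightarrow> (\<forall>k. wf_dp_level k (D k))"

definition lift_transition :: "(witness \<Rightarrow> witness set) \<Rightarrow> witness set \<Rightarrow> witness set" where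
  "lift_transition t S = (\<Union>w\<in>S. t w)"

definition lift_transition2 ::
    "(witness \<Rightarrow> witness \<Rightarrow> witness set) \<Rightarrow> witness set \<Rightarrow> witness set \<Rightarrow> witness set" where
  "lift_transition2 t S S' = (\<Union>w\<in>S. \<Union>w'\<in>S'. t w w')"

fun dyn :: "dp_level \<Rightarrow> itd \<Rightarrow> witness set" where
  "dyn L Leaf = leaf_wits L"
| "dyn L (IntroVertex u \<sigma>) = clean L (lift_transition (intro_vertex L u) (dyn L \<sigma>))"
| "dyn L (ForgetVertex u \<sigma>) = clean L (lift_transition (forget_vertex L u) (dyn L \<sigma>))"
| "dyn L (IntroEdge u v \<sigma>) = clean L (lift_transition (intro_edge L u v) (dyn L \<sigma>))"
| "dyn L (Join \<sigma>1 \<sigma>2) = clean L (lift_transition2 (join_wits L) (dyn L \<sigma>1) (dyn L \<sigma>2))"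

definition accepts :: "dp_level \<Rightarrow> itd \<Rightarrow> bool" where
  "accepts L \<tau> \<longleftrightarrow> (\<exists>w\<in>dyn L \<tau>. final L w)"

definition graph_property :: "(nat \<Rightarrow> dp_level) \<Rightarrow> graph set" where
  "graph_property D =
     (\<Union>k. {G. wf_graph G \<and> (\<exists>\<tau>\<in>itds k. accepts (D k) \<tau> \<and> graph_iso (itd_graph \<tau>) G)})"

definition identity_cleaning :: "(nat \<Rightarrow> dp_level) \<Rightarrow> bool" where
  "identity_cleaning D \<longleftrightarrow> (\<forall>k. \<forall>S\<in>fin_subsets (D k). clean (D k) S = S)"

definition coherent :: "(nat \<Rightarrow> dp_level) \<Rightarrow> bool" where
  "coherent D \<longleftrightarrow> (\<forall>k k'. \<forall>\<tau>\<in>itds k. \<forall>\<tau>'\<in>itds k'.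
     graph_iso (itd_graph \<tau>) (itd_graph \<tau>') \<longrightarrow> (accepts (D k) \<tau> \<longleftrightarrow> accepts (D k') \<tau>'))"


section \<open>Labels, relabelings and witness actions\<close>

definition witness_labelling :: "(nat \<Rightarrow> dp_level) \<Rightarrow> (nat \<Rightarrow> witness \<Rightarrow> nat set) \<Rightarrow> bool" where
  "witness_labelling D Lbl \<longleftrightarrow> (\<forall>k. \<forall>w\<in>wits (D k). Lbl k w \<subseteq> labels k)"

definition relabelings :: "nat \<Rightarrow> (nat \<rightharpoonup> nat) set" where
  "relabelings k = {f. dom f \<subseteq> labels k \<and> ran f \<subseteq> labels k \<and> inj_on f (dom f)}"

type_synonym action = "(nat \<rightharpoonup> nat) \<Rightarrow> witness \<rightharpoonup> witness"

definition act_set :: "action \<Rightarrow> (nat \<rightharpoonup> nat) \<Rightarrow> witness set \<rightharpoonup> witness set" where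
  "act_set \<rho> f S = (if S \<subseteq> dom (\<rho> f) then Some (map_image (\<rho> f) S) else None)"

text \<open>Equations between partial expressions are required whenever both sides are defined.\<close>

definition witness_action ::
    "nat \<Rightarrow> dp_level \<Rightarrow> (witness \<Rightarrow> nat set) \<Rightarrow> action \<Rightarrow> bool" where
  "witness_action k L lbl \<rho> \<longleftrightarrow>
     (\<forall>f\<in>relabelings k. \<forall>w\<in>wits L. w \<in> dom (\<rho> f) \<longleftrightarrow> lbl w \<subseteq> dom f) \<and>
     (\<forall>f\<in>relabelings k. \<forall>w\<in>wits L. \<forall>w'. \<rho> f w = Some w' \<longrightarrow>
        w' \<in> wits L \<and> (final L w' \<longleftrightarrow> final L w) \<and> lbl w' = map_image f (lbl w) \<and>
        \<rho> (map_inv f) w' = Some w) \<and>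
     (\<forall>f\<in>relabelings k. \<forall>f'\<in>relabelings k. \<forall>w\<in>wits L. \<forall>w' w''.
        \<rho> f' w = Some w' \<and> \<rho> f w' = Some w'' \<longrightarrow> \<rho> (f \<circ>\<^sub>m f') w = Some w'') \<and>
     (\<forall>f\<in>relabelings k. \<forall>f'\<in>relabelings k. \<forall>w\<in>wits L. \<forall>w'.
        f \<subseteq>\<^sub>m f' \<and> \<rho> f w = Some w' \<longrightarrow> \<rho> f' w = Some w') \<and>
     (\<forall>f\<in>relabelings k. \<forall>w\<in>wits L. \<forall>w' T u u'.
        f u = Some u' \<and> \<rho> f w = Some w' \<and> act_set \<rho> f (intro_vertex L u w) = Some T \<longrightarrow>
        T = intro_vertex L u' w') \<and>
     (\<forall>f\<in>relabelings k. \<forall>w\<in>wits L. \<forall>w' T u u'.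
        f u = Some u' \<and> \<rho> f w = Some w' \<and> act_set \<rho> f (forget_vertex L u w) = Some T \<longrightarrow>
        T = forget_vertex L u' w') \<and>
     (\<forall>f\<in>relabelings k. \<forall>w\<in>wits L. \<forall>w' T u v u' v'.
        u \<noteq> v \<and> f u = Some u' \<and> f v = Some v' \<and> \<rho> f w = Some w' \<and>
        act_set \<rho> f (intro_edge L u v w) = Some T \<longrightarrow>
        T = intro_edge L u' v' w') \<and>
     (\<forall>f\<in>relabelings k. \<forall>w1\<in>wits L. \<forall>w2\<in>wits L. \<forall>w1' w2' T.
        \<rho> f w1 = Some w1' \<and> \<rho> f w2 = Some w2' \<and> act_set \<rho> f (join_wits L w1 w2) = Some T \<longrightarrow>
        T = join_wits L w1' w2')"


section \<open>Relabeled refutations\<close>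

type_synonym state = "nat set \<times> witness set"

definition is_state :: "nat \<Rightarrow> dp_level \<Rightarrow> state \<Rightarrow> bool" where
  "is_state k L = (\<lambda>(b, S). b \<subseteq> labels k \<and> S \<in> fin_subsets L)"

definition well_formed :: "(witness \<Rightarrow> nat set) \<Rightarrow> state \<Rightarrow> bool" where
  "well_formed lbl = (\<lambda>(b, S). (\<Union>w\<in>S. lbl w) \<subseteq> b)"

definition inconsistent :: "dp_level \<Rightarrow> state \<Rightarrow> bool" where
  "inconsistent L = (\<lambda>(b, S). \<not> (\<exists>w\<in>S. final L w))"

definition initial_state :: "dp_level \<Rightarrow> state" where
  "initial_state L = ({}, leaf_wits L)"

definition relabels_to :: "action \<Rightarrow> (nat \<rightharpoonup> nat) \<Rightarrow> state \<Rightarrow> state \<Rightarrow> bool" where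
  "relabels_to \<rho> f = (\<lambda>(b, S) (b', S').
     dom f = b \<and> b' = map_image f b \<and> act_set \<rho> f S = Some S')"

inductive refutation_step ::
    "nat \<Rightarrow> dp_level \<Rightarrow> action \<Rightarrow> state set \<Rightarrow> (nat \<rightharpoonup> nat) \<Rightarrow> state \<Rightarrow> bool"
  for k L \<rho> Prev f where
  step_intro_vertex:
    "(b, S) \<in> Prev \<Longrightarrow> u \<in> labels k \<Longrightarrow> u \<notin> b \<Longrightarrow>
     relabels_to \<rho> f (b \<union> {u}, lift_transition (intro_vertex L u) S) s \<Longrightarrow>
     refutation_step k L \<rho> Prev f s"
| step_forget_vertex:
    "(b, S) \<in> Prev \<Longrightarrow> u \<in> b \<Longrightarrow>
     relabels_to \<rho> f (b - {u}, lift_transition (forget_vertex L u) S) s \<Longrightarrow>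
     refutation_step k L \<rho> Prev f s"
| step_intro_edge:
    "(b, S) \<in> Prev \<Longrightarrow> u \<in> b \<Longrightarrow> v \<in> b \<Longrightarrow> u \<noteq> v \<Longrightarrow>
     relabels_to \<rho> f (b, lift_transition (intro_edge L u v) S) s \<Longrightarrow>
     refutation_step k L \<rho> Prev f s"
| step_join:
    "(b, S) \<in> Prev \<Longrightarrow> (b, S') \<in> Prev \<Longrightarrow>
     \<pi> \<in> relabelings k \<Longrightarrow> dom \<pi> = b \<Longrightarrow> ran \<pi> = b \<Longrightarrow>
     act_set \<rho> \<pi> S' = Some S'' \<Longrightarrow>
     relabels_to \<rho> f (b, lift_transition2 (join_wits L) S S'') s \<Longrightarrow>
     refutation_step k L \<rho> Prev f s"

text \<open>The lists \<open>F\<close> and \<open>ss\<close> enumerate the relabelings with indices 1 to m and the states with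
  indices 0 to m, so the i-th relabeling is \<open>F ! (i - 1)\<close>.\<close>

definition relabeled_refutation ::
    "nat \<Rightarrow> dp_level \<Rightarrow> (witness \<Rightarrow> nat set) \<Rightarrow> action \<Rightarrow> (nat \<rightharpoonup> nat) list \<Rightarrow> state list \<Rightarrow> bool" where
  "relabeled_refutation k L lbl \<rho> F ss \<longleftrightarrow>
     length ss = length F + 1 \<and>
     (\<forall>s\<in>set ss. is_state k L s \<and> well_formed lbl s) \<and>
     ss ! 0 = initial_state L \<and>
     inconsistent L (ss ! length F) \<and>
     (\<forall>i\<in>{1..length F}.
        refutation_step k L \<rho> {ss ! j | j. j < i} (F ! (i - 1)) (ss ! i))"

end

theory Submission
  imports Defs
begin

text \<open>
  Every relabeling extends to a permutation \<open>p\<close> of \<open>[k + 1]\<close>, and applying \<open>p\<close> to all labels of a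
  term \<open>\<tau>\<close> gives a term whose dynamization is \<open>\<rho>(p, Dyn(\<tau>))\<close>: the action of \<open>p\<close> is defined on all
  witnesses and commutes with the transitions, and it fixes the leaf witnesses, because these have
  no labels (the initial state is well-formed) and the empty relabeling acts as the identity.
  Hence every state \<open>(b, S)\<close> of a relabeled refutation is \<open>(B(\<tau>), Dyn(\<tau>))\<close> for some term \<open>\<tau>\<close>.
  The term for the last state is rejected, and by coherence its graph lies outside the property.
\<close>

section \<open>Permutations of the label set and their effect on terms\<close>

definition perm_map :: "nat \<Rightarrow> (nat \<Rightarrow> nat) \<Rightarrow> nat \<rightharpoonup> nat" where
  "perm_map k p = (Some \<circ> p) |` labels k"

text \<open>The map is applied at every node, so it also renames labels that are forgotten on the
  way up. A relabeling defined only on the top bag would not say where those go, hence the use of a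
  function on all labels.\<close>

primrec relabel_itd :: "(nat \<Rightarrow> nat) \<Rightarrow> itd \<Rightarrow> itd" where
  "relabel_itd p Leaf = Leaf"
| "relabel_itd p (IntroVertex u \<sigma>) = IntroVertex (p u) (relabel_itd p \<sigma>)"
| "relabel_itd p (ForgetVertex u \<sigma>) = ForgetVertex (p u) (relabel_itd p \<sigma>)"
| "relabel_itd p (IntroEdge u v \<sigma>) = IntroEdge (p u) (p v) (relabel_itd p \<sigma>)"
| "relabel_itd p (Join \<sigma>1 \<sigma>2) = Join (relabel_itd p \<sigma>1) (relabel_itd p \<sigma>2)"

lemma perm_map_apply: "u \<in> labels k \<Longrightarrow> perm_map k p u = Some (p u)"
  by (simp add: perm_map_def)

lemma dom_perm_map [simp]: "dom (perm_map k p) = labels k"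
  by (auto simp: perm_map_def)

lemma perm_map_relabeling:
  assumes "bij_betw p (labels k) (labels k)"
  shows "perm_map k p \<in> relabelings k"
proof -
  have "ran (perm_map k p) = p ` labels k"
    by (auto simp: ran_def perm_map_def restrict_map_def split: if_splits)
  moreover have "inj_on (perm_map k p) (labels k)"
    using assms by (auto simp: inj_on_def bij_betw_def perm_map_apply)
  ultimately show ?thesis
    using assms by (auto simp: relabelings_def bij_betw_def)
qed

text \<open>By injectivity the domain and the range of \<open>f\<close> have equal size, and so do
  their complements in the finite set \<open>labels k\<close>. Any bijection \<open>h\<close>
  between the complements completes \<open>f\<close>.\<close>

lemma relabeling_extends_to_perm:
  assumes "f \<in> relabelings k"
  obtains p where "bij_betw p (labels k) (labels k)" "f \<subseteq>\<^sub>m perm_map k p"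
proof -
  let ?g = "\<lambda>u. the (f u)"
  have f: "dom f \<subseteq> labels k" "ran f \<subseteq> labels k" "inj_on f (dom f)"
    using assms by (auto simp: relabelings_def)
  have inj: "inj_on ?g (dom f)"
    using f(3) by (fastforce simp: inj_on_def dom_def)
  have img: "?g ` dom f = ran f"
    by (force simp: ran_def dom_def image_iff)
  have g: "bij_betw ?g (dom f) (ran f)"
    using inj img by (simp add: bij_betw_def)
  have "card (dom f) = card (ran f)"
    using g by (rule bij_betw_same_card)
  then have "card (labels k - dom f) = card (labels k - ran f)"
    using f by (simp add: card_Diff_subset finite_subset[OF _ finite_atLeastAtMost])
  then obtain h where h: "bij_betw h (labels k - dom f) (labels k - ran f)"
    using finite_same_card_bij[of "labels k - dom f" "labels k - ran f"] by auto
  define p where "p = (\<lambda>u. if u \<in> dom f then ?g u else h u)"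
  have "bij_betw p (dom f \<union> (labels k - dom f)) (ran f \<union> (labels k - ran f))"
    unfolding p_def by (rule bij_betw_disjoint_Un) (use g h in auto)
  moreover have "dom f \<union> (labels k - dom f) = labels k" "ran f \<union> (labels k - ran f) = labels k"
    using f by auto
  ultimately have "bij_betw p (labels k) (labels k)" by simp
  moreover have "f \<subseteq>\<^sub>m perm_map k p"
    using f(1) by (auto simp: map_le_def p_def perm_map_apply subset_iff dom_def)
  ultimately show thesis by (rule that)
qed

lemma bag_subset_labels: "legal k \<tau> \<Longrightarrow> bag \<tau> \<subseteq> labels k"
  by (induction \<tau>) auto

text \<open>Only \<open>ForgetVertex\<close> needs injectivity: there the image of a set difference
  must be the difference of the images. Legality keeps all bags inside \<open>labels k\<close>,
  where \<open>p\<close> is injective.\<close>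

lemma bag_relabel_itd:
  assumes "inj_on p (labels k)" "legal k \<tau>"
  shows "bag (relabel_itd p \<tau>) = p ` bag \<tau>"
  using assms(2)
proof (induction \<tau>)
  case (ForgetVertex u \<tau>)
  then show ?case
    using inj_on_image_set_diff[OF assms(1), of "bag \<tau>" "{u}"] bag_subset_labels[of k \<tau>] by auto
qed auto

text \<open>Injectivity preserves the freshness of an introduced label and the distinctness of the
  ends of an edge; that \<open>p\<close> maps \<open>labels k\<close> to itself keeps the labels in
  range.\<close>

lemma legal_relabel_itd:
  assumes "bij_betw p (labels k) (labels k)" "legal k \<tau>"
  shows "legal k (relabel_itd p \<tau>)"
proof -
  have p: "p u \<in> labels k" if "u \<in> labels k" for u
    using bij_betwE[OF assms(1)] that by blast
  have inj: "inj_on p (labels k)"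
    using assms(1) by (rule bij_betw_imp_inj_on)
  show ?thesis
    using assms(2)
  proof (induction \<tau>)
    case (IntroVertex u \<tau>)
    then have "p u \<notin> p ` bag \<tau>"
      using inj_on_image_mem_iff[OF inj, of u "bag \<tau>"] bag_subset_labels[of k \<tau>] by simp
    then show ?case
      using IntroVertex p[of u] by (simp add: bag_relabel_itd[OF inj])
  next
    case (ForgetVertex u \<tau>)
    then show ?case using p[of u] by (simp add: bag_relabel_itd[OF inj])
  next
    case (IntroEdge u v \<tau>)
    then have "p u \<noteq> p v" using inj by (auto simp: inj_on_def)
    then show ?case
      using IntroEdge p[of u] p[of v] by (simp add: bag_relabel_itd[OF inj])
  qed (simp_all add: bag_relabel_itd[OF inj])
qed

text \<open>A single level of the core is enough until coherence enters. The condition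
  \<open>lbl_leaf\<close> is not a law of cores or actions: it will come from the well-formedness of
  the initial state of a refutation.\<close>

locale dp_level_with_action =
  fixes k :: nat and L :: dp_level and lbl :: "witness \<Rightarrow> nat set" and \<rho> :: action
  assumes wf_level: "wf_dp_level k L"
    and clean_id: "S \<in> fin_subsets L \<Longrightarrow> clean L S = S"
    and lbl_subset: "w \<in> wits L \<Longrightarrow> lbl w \<subseteq> labels k"
    and action: "witness_action k L lbl \<rho>"
    and lbl_leaf: "w \<in> leaf_wits L \<Longrightarrow> lbl w = {}"
begin

definition act :: "(nat \<Rightarrow> nat) \<Rightarrow> witness \<Rightarrow> witness" where
  "act p w = the (\<rho> (perm_map k p) w)"

lemma leaf_fin: "leaf_wits L \<in> fin_subsets L"
  and intro_vertex_fin: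
    "u \<in> labels k \<Longrightarrow> w \<in> wits L \<Longrightarrow> intro_vertex L u w \<in> fin_subsets L"
  and forget_vertex_fin:
    "u \<in> labels k \<Longrightarrow> w \<in> wits L \<Longrightarrow> forget_vertex L u w \<in> fin_subsets L"
  and intro_edge_fin:
    "u \<in> labels k \<Longrightarrow> v \<in> labels k \<Longrightarrow> u \<noteq> v \<Longrightarrow> w \<in> wits L \<Longrightarrow>
      intro_edge L u v w \<in> fin_subsets L"
  and join_fin: "w \<in> wits L \<Longrightarrow> w' \<in> wits L \<Longrightarrow> join_wits L w w' \<in> fin_subsets L"
  using wf_level unfolding wf_dp_level_def by blast+

lemma lift_transition_fin:
  "S \<in> fin_subsets L \<Longrightarrow> (\<And>w. w \<in> wits L \<Longrightarrow> t w \<in> fin_subsets L) \<Longrightarrow>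
    lift_transition t S \<in> fin_subsets L"
  by (auto simp: lift_transition_def fin_subsets_def subset_iff)

lemma lift_transition2_fin:
  "S \<in> fin_subsets L \<Longrightarrow> S' \<in> fin_subsets L \<Longrightarrow>
    (\<And>w w'. w \<in> wits L \<Longrightarrow> w' \<in> wits L \<Longrightarrow> t w w' \<in> fin_subsets L) \<Longrightarrow>
    lift_transition2 t S S' \<in> fin_subsets L"
  by (auto simp: lift_transition2_def fin_subsets_def subset_iff)

text \<open>Cleaning is known to be the identity only on finite sets of witnesses; this invariant is
  what removes \<open>clean\<close> from the four equations below.\<close>

lemma dyn_fin: "legal k \<tau> \<Longrightarrow> dyn L \<tau> \<in> fin_subsets L"
  by (induction \<tau>)
    (simp_all add: clean_id lift_transition_fin lift_transition2_fin leaf_fin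
      intro_vertex_fin forget_vertex_fin intro_edge_fin join_fin del: atLeastAtMost_iff)

lemma dyn_IntroVertex:
  "legal k (IntroVertex u \<tau>) \<Longrightarrow>
    dyn L (IntroVertex u \<tau>) = lift_transition (intro_vertex L u) (dyn L \<tau>)"
  by (simp add: clean_id lift_transition_fin dyn_fin intro_vertex_fin del: atLeastAtMost_iff)

lemma dyn_ForgetVertex:
  "legal k (ForgetVertex u \<tau>) \<Longrightarrow>
    dyn L (ForgetVertex u \<tau>) = lift_transition (forget_vertex L u) (dyn L \<tau>)"
  by (simp add: clean_id lift_transition_fin dyn_fin forget_vertex_fin del: atLeastAtMost_iff)

lemma dyn_IntroEdge:
  "legal k (IntroEdge u v \<tau>) \<Longrightarrow>
    dyn L (IntroEdge u v \<tau>) = lift_transition (intro_edge L u v) (dyn L \<tau>)"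
  by (simp add: clean_id lift_transition_fin dyn_fin intro_edge_fin del: atLeastAtMost_iff)

lemma dyn_Join:
  "legal k (Join \<sigma> \<tau>) \<Longrightarrow>
    dyn L (Join \<sigma> \<tau>) = lift_transition2 (join_wits L) (dyn L \<sigma>) (dyn L \<tau>)"
  by (simp add: clean_id lift_transition2_fin dyn_fin join_fin)

section \<open>Laws of the witness action\<close>

lemma action_dom: "f \<in> relabelings k \<Longrightarrow> w \<in> wits L \<Longrightarrow> w \<in> dom (\<rho> f) \<longleftrightarrow> lbl w \<subseteq> dom f"
  by (rule action[unfolded witness_action_def, THEN conjunct1, rule_format])

lemma action_inv: "f \<in> relabelings k \<Longrightarrow> w \<in> wits L \<Longrightarrow> \<rho> f w = Some w' \<Longrightarrow>
    w' \<in> wits L \<and> \<rho> (map_inv f) w' = Some w"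
  using action[unfolded witness_action_def, THEN conjunct2, THEN conjunct1]
  by blast

lemma action_comp: "f \<in> relabelings k \<Longrightarrow> f' \<in> relabelings k \<Longrightarrow> w \<in> wits L \<Longrightarrow>
    \<rho> f' w = Some w' \<Longrightarrow> \<rho> f w' = Some w'' \<Longrightarrow> \<rho> (f \<circ>\<^sub>m f') w = Some w''"
  using action[unfolded witness_action_def, THEN conjunct2, THEN conjunct2, THEN conjunct1]
  by blast

lemma action_extend: "f \<in> relabelings k \<Longrightarrow> f' \<in> relabelings k \<Longrightarrow> w \<in> wits L \<Longrightarrow>
    f \<subseteq>\<^sub>m f' \<Longrightarrow> \<rho> f w = Some w' \<Longrightarrow> \<rho> f' w = Some w'"
  using action[unfolded witness_action_def, THEN conjunct2, THEN conjunct2,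
      THEN conjunct2, THEN conjunct1]
  by blast

lemma action_intro_vertex: "f \<in> relabelings k \<Longrightarrow> w \<in> wits L \<Longrightarrow> f u = Some u' \<Longrightarrow>
    \<rho> f w = Some w' \<Longrightarrow> act_set \<rho> f (intro_vertex L u w) = Some T \<Longrightarrow> T = intro_vertex L u' w'"
  using action[unfolded witness_action_def, THEN conjunct2, THEN conjunct2,
      THEN conjunct2, THEN conjunct2, THEN conjunct1]
  by blast

lemma action_forget_vertex: "f \<in> relabelings k \<Longrightarrow> w \<in> wits L \<Longrightarrow> f u = Some u' \<Longrightarrow>
    \<rho> f w = Some w' \<Longrightarrow> act_set \<rho> f (forget_vertex L u w) = Some T \<Longrightarrow> T = forget_vertex L u' w'"
  using action[unfolded witness_action_def, THEN conjunct2, THEN conjunct2,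
      THEN conjunct2, THEN conjunct2, THEN conjunct2, THEN conjunct1]
  by blast

lemma action_intro_edge: "f \<in> relabelings k \<Longrightarrow> w \<in> wits L \<Longrightarrow> u \<noteq> v \<Longrightarrow>
    f u = Some u' \<Longrightarrow> f v = Some v' \<Longrightarrow> \<rho> f w = Some w' \<Longrightarrow>
    act_set \<rho> f (intro_edge L u v w) = Some T \<Longrightarrow> T = intro_edge L u' v' w'"
  using action[unfolded witness_action_def, THEN conjunct2, THEN conjunct2,
      THEN conjunct2, THEN conjunct2, THEN conjunct2, THEN conjunct2, THEN conjunct1]
  by blast

lemma action_join: "f \<in> relabelings k \<Longrightarrow> w1 \<in> wits L \<Longrightarrow> w2 \<in> wits L \<Longrightarrow>
    \<rho> f w1 = Some w1' \<Longrightarrow> \<rho> f w2 = Some w2' \<Longrightarrow>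
    act_set \<rho> f (join_wits L w1 w2) = Some T \<Longrightarrow> T = join_wits L w1' w2'"
  using action[unfolded witness_action_def, THEN conjunct2, THEN conjunct2,
      THEN conjunct2, THEN conjunct2, THEN conjunct2, THEN conjunct2, THEN conjunct2]
  by blast

text \<open>The empty map is its own inverse and its own composite with itself. Acting with it twice
  returns to \<open>w\<close> by the inverse law, and by the composition law the two actions amount
  to one.\<close>

lemma action_empty:
  assumes "w \<in> wits L" "lbl w = {}"
  shows "\<rho> Map.empty w = Some w"
proof -
  have e: "Map.empty \<in> relabelings k" by (simp add: relabelings_def)
  obtain w' where w': "\<rho> Map.empty w = Some w'"
    using action_dom[OF e assms(1)] assms(2) by auto
  have "map_inv (Map.empty :: nat \<rightharpoonup> nat) = Map.empty"
    by (simp add: map_inv_def)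
  then have "\<rho> Map.empty w' = Some w"
    using action_inv[OF e assms(1) w'] by simp
  then have "\<rho> (Map.empty \<circ>\<^sub>m (Map.empty :: nat \<rightharpoonup> nat)) w = Some w"
    by (rule action_comp[OF e e assms(1) w'])
  then show ?thesis by simp
qed

section \<open>The action of a permutation of all labels\<close>

context
  fixes p :: "nat \<Rightarrow> nat"
  assumes p: "bij_betw p (labels k) (labels k)"
begin

text \<open>The labels of a witness lie in \<open>labels k\<close>, the whole domain of
  \<open>perm_map k p\<close>, so a permutation acts on every witness. A smaller relabeling need not
  act on the witnesses computed inside a term.\<close>

lemma action_perm_map:
  assumes "w \<in> wits L"
  shows "\<rho> (perm_map k p) w = Some (act p w)"
  using action_dom[OF perm_map_relabeling[OF p] assms] lbl_subset[OF assms]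
  by (auto simp: act_def)

lemma act_in_wits: "w \<in> wits L \<Longrightarrow> act p w \<in> wits L"
  using action_inv[OF perm_map_relabeling[OF p]] action_perm_map by blast

lemma act_set_perm_map:
  assumes "S \<in> fin_subsets L"
  shows "act_set \<rho> (perm_map k p) S = Some (act p ` S)"
proof -
  have *: "\<rho> (perm_map k p) w = Some (act p w)" if "w \<in> S" for w
    using that assms action_perm_map by (auto simp: fin_subsets_def)
  then have "S \<subseteq> dom (\<rho> (perm_map k p))" by blast
  moreover have "map_image (\<rho> (perm_map k p)) S = act p ` S"
    using * by (force simp: map_image_def)
  ultimately show ?thesis by (simp add: act_set_def)
qed

text \<open>The commutation laws ask that both sides be defined. For a permutation this always
  holds, since transitions yield finite sets of witnesses; the same applies to the next three
  lemmas.\<close>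

lemma act_intro_vertex: "u \<in> labels k \<Longrightarrow> w \<in> wits L \<Longrightarrow>
    act p ` intro_vertex L u w = intro_vertex L (p u) (act p w)"
  by (rule action_intro_vertex[OF perm_map_relabeling[OF p] _ perm_map_apply action_perm_map
        act_set_perm_map[OF intro_vertex_fin]])

lemma act_forget_vertex: "u \<in> labels k \<Longrightarrow> w \<in> wits L \<Longrightarrow>
    act p ` forget_vertex L u w = forget_vertex L (p u) (act p w)"
  by (rule action_forget_vertex[OF perm_map_relabeling[OF p] _ perm_map_apply action_perm_map
        act_set_perm_map[OF forget_vertex_fin]])

lemma act_intro_edge: "u \<in> labels k \<Longrightarrow> v \<in> labels k \<Longrightarrow> u \<noteq> v \<Longrightarrow> w \<in> wits L \<Longrightarrow>
    act p ` intro_edge L u v w = intro_edge L (p u) (p v) (act p w)"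
  by (rule action_intro_edge[OF perm_map_relabeling[OF p] _ _ perm_map_apply perm_map_apply
        action_perm_map act_set_perm_map[OF intro_edge_fin]])

lemma act_join: "w \<in> wits L \<Longrightarrow> w' \<in> wits L \<Longrightarrow>
    act p ` join_wits L w w' = join_wits L (act p w) (act p w')"
  by (rule action_join[OF perm_map_relabeling[OF p] _ _ action_perm_map action_perm_map
        act_set_perm_map[OF join_fin]])

text \<open>A leaf witness has no labels, so the empty relabeling fixes it, and every relabeling
  extends the empty one.\<close>

lemma act_leaf: "w \<in> leaf_wits L \<Longrightarrow> act p w = w"
proof -
  assume w: "w \<in> leaf_wits L"
  then have "w \<in> wits L" using leaf_fin by (auto simp: fin_subsets_def)
  moreover have "Map.empty \<in> relabelings k" by (simp add: relabelings_def)
  ultimately have "\<rho> (perm_map k p) w = Some w"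
    using action_extend[OF _ perm_map_relabeling[OF p] _ _ action_empty] lbl_leaf[OF w] by simp
  then show ?thesis by (simp add: act_def)
qed

lemma act_lift_transition:
  assumes "S \<in> fin_subsets L" "\<And>w. w \<in> wits L \<Longrightarrow> act p ` t w = t' (act p w)"
  shows "lift_transition t' (act p ` S) = act p ` lift_transition t S"
proof -
  have "act p ` t w = t' (act p w)" if "w \<in> S" for w
    using assms(1) that by (intro assms(2)) (auto simp: fin_subsets_def)
  then show ?thesis by (simp add: lift_transition_def image_UN)
qed

lemma act_lift_transition2:
  assumes "S \<in> fin_subsets L" "S' \<in> fin_subsets L"
    and "\<And>w w'. w \<in> wits L \<Longrightarrow> w' \<in> wits L \<Longrightarrow> act p ` t w w' = t' (act p w) (act p w')"
  shows "lift_transition2 t' (act p ` S) (act p ` S') = act p ` lift_transition2 t S S'"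
proof -
  have "act p ` t w w' = t' (act p w) (act p w')" if "w \<in> S" "w' \<in> S'" for w w'
    using assms(1,2) that by (intro assms(3)) (auto simp: fin_subsets_def)
  then show ?thesis by (simp add: lift_transition2_def image_UN)
qed

lemma dyn_relabel_itd: "legal k \<tau> \<Longrightarrow> dyn L (relabel_itd p \<tau>) = act p ` dyn L \<tau>"
proof (induction \<tau>)
  case Leaf
  then show ?case by (simp add: act_leaf)
next
  case (IntroVertex u \<tau>)
  \<comment> \<open>Legality of the relabeled term is needed to drop \<open>clean\<close> on its
    side of the equation too.\<close>
  have r: "legal k (IntroVertex (p u) (relabel_itd p \<tau>))"
    using legal_relabel_itd[OF p IntroVertex.prems] by simp
  have "u \<in> labels k" "legal k \<tau>" using IntroVertex.prems by simp_all
  then show ?case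
    using IntroVertex.IH
    \<comment> \<open>The unpermuted transition occurs only on the right of
      \<open>act_lift_transition\<close>, so matching cannot find it and it is given
      explicitly.\<close>
    by (simp only: relabel_itd.simps dyn_IntroVertex[OF r] dyn_IntroVertex[OF IntroVertex.prems]
        act_lift_transition[of _ "intro_vertex L u" "intro_vertex L (p u)", OF dyn_fin act_intro_vertex])
next
  case (ForgetVertex u \<tau>)
  have r: "legal k (ForgetVertex (p u) (relabel_itd p \<tau>))"
    using legal_relabel_itd[OF p ForgetVertex.prems] by simp
  have "u \<in> labels k" "legal k \<tau>" using ForgetVertex.prems by simp_all
  then show ?case
    using ForgetVertex.IH
    by (simp only: relabel_itd.simps dyn_ForgetVertex[OF r] dyn_ForgetVertex[OF ForgetVertex.prems]
        act_lift_transition[of _ "forget_vertex L u" "forget_vertex L (p u)", OF dyn_fin act_forget_vertex])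
next
  case (IntroEdge u v \<tau>)
  have r: "legal k (IntroEdge (p u) (p v) (relabel_itd p \<tau>))"
    using legal_relabel_itd[OF p IntroEdge.prems] by simp
  have "u \<in> labels k" "v \<in> labels k" "u \<noteq> v" "legal k \<tau>" using IntroEdge.prems by simp_all
  then show ?case
    using IntroEdge.IH
    \<comment> \<open>The side condition \<open>u \<noteq> v\<close> is rewritten to
      \<open>\<not> False\<close> by the assumption; \<open>not_False_eq_True\<close> closes
      it.\<close>
    by (simp only: relabel_itd.simps dyn_IntroEdge[OF r] dyn_IntroEdge[OF IntroEdge.prems]
        act_lift_transition[of _ "intro_edge L u v" "intro_edge L (p u) (p v)", OF dyn_fin act_intro_edge] not_False_eq_True)
next
  case (Join \<sigma> \<tau>)
  have r: "legal k (Join (relabel_itd p \<sigma>) (relabel_itd p \<tau>))"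
    using legal_relabel_itd[OF p Join.prems] by simp
  have "legal k \<sigma>" "legal k \<tau>" using Join.prems by simp_all
  then show ?case
    using Join.IH
    by (simp only: relabel_itd.simps dyn_Join[OF r] dyn_Join[OF Join.prems]
        act_lift_transition2[of _ _ "join_wits L" "join_wits L", OF dyn_fin dyn_fin act_join])
qed

end

section \<open>Realizing the states of a refutation by terms\<close>

lemma relabeled_itd_exists:
  assumes "legal k \<tau>" "f \<in> relabelings k" "dom f = bag \<tau>" "act_set \<rho> f (dyn L \<tau>) = Some T"
  shows "\<exists>\<tau>'. legal k \<tau>' \<and> bag \<tau>' = map_image f (bag \<tau>) \<and> dyn L \<tau>' = T"
proof -
  \<comment> \<open>The term sought is \<open>relabel_itd p \<tau>\<close>: the permutation
    \<open>p\<close> agrees with \<open>f\<close> on the top bag, and by the extension law also on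
    the witnesses in \<open>dyn L \<tau>\<close>.\<close>
  obtain p where p: "bij_betw p (labels k) (labels k)" and ext: "f \<subseteq>\<^sub>m perm_map k p"
    using relabeling_extends_to_perm[OF assms(2)] .
  have "f u = Some (p u)" if "u \<in> bag \<tau>" for u
    using that ext assms(3) bag_subset_labels[OF assms(1)] perm_map_apply[of u k p]
    by (auto simp: map_le_def)
  then have bag: "map_image f (bag \<tau>) = p ` bag \<tau>"
    by (force simp: map_image_def)
  have sub: "dyn L \<tau> \<subseteq> dom (\<rho> f)" and T: "T = map_image (\<rho> f) (dyn L \<tau>)"
    using assms(4) by (auto simp: act_set_def split: if_splits)
  have "\<rho> f w = Some (act p w)" if w: "w \<in> dyn L \<tau>" for w
  proof -
    have "w \<in> wits L" using dyn_fin[OF assms(1)] w by (auto simp: fin_subsets_def)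
    moreover obtain w' where "\<rho> f w = Some w'" using sub w by blast
    ultimately show ?thesis
      using action_extend[OF assms(2) perm_map_relabeling[OF p] _ ext] by (simp add: act_def)
  qed
  then have "T = act p ` dyn L \<tau>"
    unfolding T by (force simp: map_image_def)
  then have "dyn L (relabel_itd p \<tau>) = T"
    by (simp add: dyn_relabel_itd[OF p assms(1)])
  then show ?thesis
    using bag legal_relabel_itd[OF p assms(1)] bag_relabel_itd[OF bij_betw_imp_inj_on[OF p] assms(1)]
    by auto
qed

definition realizable :: "state \<Rightarrow> bool" where
  "realizable s \<longleftrightarrow> (\<exists>\<tau>. legal k \<tau> \<and> s = (bag \<tau>, dyn L \<tau>))"

lemma realizable_relabels_to:
  assumes "realizable s" "f \<in> relabelings k" "relabels_to \<rho> f s s'"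
  shows "realizable s'"
  using assms relabeled_itd_exists
  by (cases s') (fastforce simp: realizable_def relabels_to_def)

text \<open>Each rule puts the matching constructor on top of terms realizing earlier states;
  \<open>realizable_relabels_to\<close> then absorbs the relabeling \<open>f\<close>.\<close>

lemma realizable_refutation_step:
  assumes step: "refutation_step k L \<rho> Prev f s" and f: "f \<in> relabelings k"
    and prev: "\<And>s. s \<in> Prev \<Longrightarrow> realizable s"
  shows "realizable s"
  using step
proof cases
  case (step_intro_vertex b S u)
  then obtain \<tau> where \<tau>: "legal k \<tau>" "bag \<tau> = b" "dyn L \<tau> = S"
    using prev by (fastforce simp: realizable_def)
  then have leg: "legal k (IntroVertex u \<tau>)" using step_intro_vertex by simp
  then have "realizable (b \<union> {u}, lift_transition (intro_vertex L u) S)"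
    using dyn_IntroVertex[OF leg] \<tau>
    by (intro realizable_def[THEN iffD2] exI[of _ "IntroVertex u \<tau>"]) simp
  then show ?thesis using realizable_relabels_to f step_intro_vertex by blast
next
  case (step_forget_vertex b S u)
  then obtain \<tau> where \<tau>: "legal k \<tau>" "bag \<tau> = b" "dyn L \<tau> = S"
    using prev by (fastforce simp: realizable_def)
  \<comment> \<open>The rule gives only \<open>u \<in> b\<close>; that \<open>u\<close> is a label
    of level \<open>k\<close> follows because \<open>b\<close> is the bag of a legal term.\<close>
  then have leg: "legal k (ForgetVertex u \<tau>)"
    using step_forget_vertex bag_subset_labels[OF \<tau>(1)] by auto
  then have "realizable (b - {u}, lift_transition (forget_vertex L u) S)"
    using dyn_ForgetVertex[OF leg] \<tau>
    by (intro realizable_def[THEN iffD2] exI[of _ "ForgetVertex u \<tau>"]) simp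
  then show ?thesis using realizable_relabels_to f step_forget_vertex by blast
next
  case (step_intro_edge b S u v)
  then obtain \<tau> where \<tau>: "legal k \<tau>" "bag \<tau> = b" "dyn L \<tau> = S"
    using prev by (fastforce simp: realizable_def)
  then have leg: "legal k (IntroEdge u v \<tau>)"
    using step_intro_edge bag_subset_labels[OF \<tau>(1)] by auto
  then have "realizable (b, lift_transition (intro_edge L u v) S)"
    using dyn_IntroEdge[OF leg] \<tau>
    by (intro realizable_def[THEN iffD2] exI[of _ "IntroEdge u v \<tau>"]) simp
  then show ?thesis using realizable_relabels_to f step_intro_edge by blast
next
  case (step_join b S S' \<pi> S'')
  obtain \<sigma> where \<sigma>: "legal k \<sigma>" "bag \<sigma> = b" "dyn L \<sigma> = S"
    using prev[OF step_join(1)] by (auto simp: realizable_def)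
  obtain \<tau>0 where \<tau>0: "legal k \<tau>0" "bag \<tau>0 = b" "dyn L \<tau>0 = S'"
    using prev[OF step_join(2)] by (auto simp: realizable_def)
  \<comment> \<open>As \<open>\<pi>\<close> permutes \<open>b\<close>, relabeling the second child
    keeps its bag, so the two children can still be joined.\<close>
  have "map_image \<pi> b = b"
    using step_join(4,5) by (auto simp: map_image_def ran_def)
  then obtain \<tau> where \<tau>: "legal k \<tau>" "bag \<tau> = b" "dyn L \<tau> = S''"
    using relabeled_itd_exists[of \<tau>0 \<pi> S''] \<tau>0 step_join by auto
  have leg: "legal k (Join \<sigma> \<tau>)" using \<sigma> \<tau> by simp
  then have "realizable (b, lift_transition2 (join_wits L) S S'')"
    using dyn_Join[OF leg] \<sigma> \<tau>
    by (intro realizable_def[THEN iffD2] exI[of _ "Join \<sigma> \<tau>"]) simp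
  then show ?thesis using realizable_relabels_to f step_join by blast
qed

lemma realizable_refutation_state:
  assumes F: "set F \<subseteq> relabelings k" and ref: "relabeled_refutation k L lbl \<rho> F ss"
    and "i \<le> length F"
  shows "realizable (ss ! i)"
  using assms(3)
\<comment> \<open>A step may use any earlier states, not just the preceding one, so strong induction
  is needed.\<close>
proof (induction i rule: less_induct)
  case (less i)
  show ?case
  proof (cases "i = 0")
    case True
    have "ss ! 0 = (bag Leaf, dyn L Leaf)"
      using ref by (simp add: relabeled_refutation_def initial_state_def)
    then show ?thesis unfolding realizable_def True using legal.simps(1) by blast
  next
    case False
    then have "refutation_step k L \<rho> {ss ! j | j. j < i} (F ! (i - 1)) (ss ! i)"
      using ref less.prems by (simp add: relabeled_refutation_def)
    \<comment> \<open>State 0 has no relabeling, so the relabeling of state \<open>i\<close> sits at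
      list position \<open>i - 1\<close>.\<close>
    moreover have "F ! (i - 1) \<in> relabelings k"
      using F less.prems False nth_mem[of "i - 1" F] by auto
    ultimately show ?thesis
      by (rule realizable_refutation_step) (use less in auto)
  qed
qed

end

section \<open>From the refutation to a graph outside the property\<close>

theorem theorem2:
  fixes k :: nat
    and F :: "(nat \<rightharpoonup> nat) list"
    and D :: "nat \<Rightarrow> dp_level"
    and Lbl :: "nat \<Rightarrow> witness \<Rightarrow> nat set"
    and \<rho> :: "nat \<Rightarrow> action"
  assumes "set F \<subseteq> relabelings k"
    and "dp_core D"
    and "coherent D"
    and "identity_cleaning D"
    and "witness_labelling D Lbl"
    and "\<forall>k'. witness_action k' (D k') (Lbl k') (\<rho> k')"
    and "\<exists>ss. relabeled_refutation k (D k) (Lbl k) (\<rho> k) F ss"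
  shows "\<exists>\<tau>\<in>itds k. itd_graph \<tau> \<notin> graph_property D"
proof -
  obtain ss where ref: "relabeled_refutation k (D k) (Lbl k) (\<rho> k) F ss"
    using assms(7) by blast
  have "0 < length ss" "ss ! 0 = initial_state (D k)"
    using ref by (simp_all add: relabeled_refutation_def)
  then have "initial_state (D k) \<in> set ss"
    using nth_mem by fastforce
  \<comment> \<open>The initial state has an empty bag, so its well-formedness forces the leaf
    witnesses to be unlabeled.\<close>
  then have "well_formed (Lbl k) (initial_state (D k))"
    using ref by (auto simp: relabeled_refutation_def)
  then have leaf: "Lbl k w = {}" if "w \<in> leaf_wits (D k)" for w
    using that by (auto simp: well_formed_def initial_state_def)
  interpret dp_level_with_action k "D k" "Lbl k" "\<rho> k"
  proof
    show "wf_dp_level k (D k)" using assms(2) by (simp add: dp_core_def)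
    show "clean (D k) S = S" if "S \<in> fin_subsets (D k)" for S
      using assms(4) that by (simp add: identity_cleaning_def)
    show "Lbl k w \<subseteq> labels k" if "w \<in> wits (D k)" for w
      using assms(5) that unfolding witness_labelling_def by blast
  qed (use assms(6) leaf in auto)
  \<comment> \<open>Here \<open>order_refl\<close> selects the index \<open>length F\<close>, that
    is the last state, which is the inconsistent one.\<close>
  obtain \<tau> where \<tau>: "legal k \<tau>" "ss ! length F = (bag \<tau>, dyn (D k) \<tau>)"
    using realizable_refutation_state[OF assms(1) ref order_refl] by (auto simp: realizable_def)
  have rejected: "\<not> accepts (D k) \<tau>"
    using ref \<tau>(2) by (simp add: relabeled_refutation_def inconsistent_def accepts_def)
  have "\<tau> \<in> itds k" using \<tau>(1) by (simp add: itds_def)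
  moreover have "itd_graph \<tau> \<notin> graph_property D"
  proof
    assume "itd_graph \<tau> \<in> graph_property D"
    then obtain k' \<tau>' where "\<tau>' \<in> itds k'" "accepts (D k') \<tau>'"
      "graph_iso (itd_graph \<tau>') (itd_graph \<tau>)"
      by (auto simp: graph_property_def)
    \<comment> \<open>The accepted term may live at another level \<open>k'\<close>; coherence
      across levels carries its acceptance to \<open>\<tau>\<close> at level \<open>k\<close>,
      against \<open>rejected\<close>.\<close>
    then show False
      using assms(3) rejected \<open>\<tau> \<in> itds k\<close> unfolding coherent_def by blast
  qed
  ultimately show ?thesis by blast
qed

end
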